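(* Let $M=U_{d,n}$ be the uniform matroid of rank $d\ge2$ on $n$ elements and let $B_0$ be any basis, $R=E\setminus B_0$. Then $C_i=B_0\cup\{i\}$ for every $i\in R$; the dead strata are exactly the sets $\sigma\subseteq R$ with $2\le|\sigma|\le d$; each dead stratum $\sigma$ has $U_\sigma=\sigma$, $b_\sigma=(1,\dots,1)$ and $K_\sigma\cong U_{d-|\sigma|,d}$; and $$F(\sigma)=\{m\in\mathbb N^\sigma:\ |m|\le d-|\sigma|\}\qquad(\sigma\text{ dead})$$ is a fibre system on $(M,B_0)$. Hence Stanley's conjecture holds for uniform matroids, i.e. $h(U_{d,n})$ is a pure $O$-sequence.
   Context: For a matroid $M$ on a finite ground set $E$ with basis $B_0$ and $i\in R=E\setminus B_0$, $C_i$ is the fundamental circuit, the unique circuit in $B_0\cup\{i\}$. For $\sigma\subseteq R$ put $m_\sigma(e)=\#\{i\in\sigma:e\in C_i\}$, $U_\sigma=\{e:m_\sigma(e)=1\}$, $A_\sigma=\{e:m_\sigma(e)\ge1\}$. A stratum is a nonempty $\sigma\subseteq R$; it is dead if $U_\sigma$ is independent in $M$, live otherwise. The baseline $b_\sigma\in\mathbb N^\sigma$ is $b_\sigma(i)=|C_i\cap U_\sigma|$; $\mathbb N^\sigma$ is identified with the vectors in $\mathbb N^R$ vanishing outside $\sigma$. $\sigma$ can be fired from $a\in\mathbb N^R$ if $a_i\ge b_\sigma(i)$ for all $i\in\sigma$. For dead $\sigma$, the dead node is $K_\sigma=(M|A_\sigma)/U_\sigma$. For $m\in\mathbb N^\sigma$,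 $|m|=\sum_i m_i$. For a matroid $N$ of rank $d$, $h(N)=(h_0,\dots,h_d)$ is the $h$-vector of its independence complex: $T_N(x,1)=\sum_kh_kx^{d-k}$. A multicomplex is a finite set of monomials (exponent vectors) closed under division; it is pure if all maximal elements have the same degree; its degree sequence counts elements of each degree (trailing zeros ignored). A pure $O$-sequence is the degree sequence of a pure multicomplex. Fibres (recursively along inclusion): given fibres $F(\tau)$ at all dead $\tau\subsetneq\sigma$, a fibre at a dead stratum $\sigma$ is a set $F(\sigma)\subseteq\mathbb N^\sigma$ such that (i) $F(\sigma)$ is a pure multicomplex with degree sequence $h(K_\sigma)$; (ii) for every $m\in F(\sigma)$, every stratum $\tau\subsetneq\sigma$ that can be fired from $b_\sigma+m$ is dead with $(b_\sigma+m)|_\tau-b_\tau\in F(\tau)$. A fibre system on $(M,B_0)$ is a choice of a fibre at every dead stratum. *)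

theory Defs
  imports "HOL-Computational_Algebra.Polynomial"
begin

section \<open>Matroids\<close>

record 'a matroid =
  ground :: "'a set"
  indeps :: "'a set set"

definition is_matroid :: "'a matroid \<Rightarrow> bool" where
  "is_matroid M \<longleftrightarrow>
     finite (ground M) \<and> indeps M \<subseteq> Pow (ground M) \<and> {} \<in> indeps M \<and>
     (\<forall>I\<in>indeps M. \<forall>J. J \<subseteq> I \<longrightarrow> J \<in> indeps M) \<and>
     (\<forall>I\<in>indeps M. \<forall>J\<in>indeps M. card I < card J \<longrightarrow> (\<exists>e\<in>J - I. insert e I \<in> indeps M))"

definition is_basis :: "'a matroid \<Rightarrow> 'a set \<Rightarrow> bool" where
  "is_basis M B \<longleftrightarrow> B \<in> indeps M \<and> (\<forall>I\<in>indeps M. B \<subseteq> I \<longrightarrow> I = B)"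

definition is_circuit :: "'a matroid \<Rightarrow> 'a set \<Rightarrow> bool" where
  "is_circuit M C \<longleftrightarrow> C \<subseteq> ground M \<and> C \<notin> indeps M \<and> (\<forall>D. D \<subset> C \<longrightarrow> D \<in> indeps M)"

definition matroid_rk :: "'a matroid \<Rightarrow> 'a set \<Rightarrow> nat" where
  "matroid_rk M X = Max (card ` {I \<in> indeps M. I \<subseteq> X})"

abbreviation matroid_rank :: "'a matroid \<Rightarrow> nat" where
  "matroid_rank M \<equiv> matroid_rk M (ground M)"

definition matroid_restrict :: "'a matroid \<Rightarrow> 'a set \<Rightarrow> 'a matroid" where
  "matroid_restrict M A = \<lparr>ground = ground M \<inter> A, indeps = {I \<in> indeps M. I \<subseteq> A}\<rparr>"

text \<open>The rank function of the contraction is \<open>I \<mapsto> rk (I \<union> X) - rk X\<close>, and \<open>I\<close> is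
  independent when its rank equals its cardinality.\<close>

definition matroid_contract :: "'a matroid \<Rightarrow> 'a set \<Rightarrow> 'a matroid" where
  "matroid_contract M X =
     \<lparr>ground = ground M - X,
      indeps = {I. I \<subseteq> ground M - X \<and> matroid_rk M (I \<union> X) = card I + matroid_rk M X}\<rparr>"

definition matroid_iso :: "'a matroid \<Rightarrow> 'b matroid \<Rightarrow> bool" where
  "matroid_iso M N \<longleftrightarrow>
     (\<exists>f. bij_betw f (ground M) (ground N) \<and>
          (\<forall>I. I \<subseteq> ground M \<longrightarrow> (I \<in> indeps M \<longleftrightarrow> f ` I \<in> indeps N)))"

text \<open>For \<open>d \<le> card E\<close> this is the uniform matroid of rank \<open>d\<close> on the ground set \<open>E\<close>.\<close>

definition uniform_matroid :: "nat \<Rightarrow> 'a set \<Rightarrow> 'a matroid" where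
  "uniform_matroid d E = \<lparr>ground = E, indeps = {I. I \<subseteq> E \<and> card I \<le> d}\<rparr>"

lemma is_matroid_uniform:
  assumes "finite E"
  shows "is_matroid (uniform_matroid d E)"
proof -
  have fin: "finite I" if "I \<subseteq> E" for I
    using that assms by (rule finite_subset)
  have sub: "card J \<le> d" if "I \<subseteq> E" "card I \<le> d" "J \<subseteq> I" for I J
    using card_mono[OF fin[OF that(1)] that(3)] that(2) by simp
  have ex: "\<exists>e\<in>J - I. insert e I \<subseteq> E \<and> card (insert e I) \<le> d"
    if IJ: "I \<subseteq> E" "J \<subseteq> E" "card J \<le> d" "card I < card J" for I J
  proof -
    have "\<not> J \<subseteq> I"
      using card_mono[OF fin[OF IJ(1)]] IJ(4) by (meson linorder_not_less)
    then obtain e where e: "e \<in> J" "e \<notin> I"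
      by blast
    have "card (insert e I) \<le> d"
      using e IJ fin[OF IJ(1)] by simp
    then show ?thesis
      using e IJ(1,2) by (intro bexI[of _ e]) auto
  qed
  show ?thesis
    unfolding is_matroid_def uniform_matroid_def matroid.select_convs
  proof (intro conjI ballI allI impI)
    fix I J assume "I \<in> {I. I \<subseteq> E \<and> card I \<le> d}" "J \<subseteq> I"
    then show "J \<in> {I. I \<subseteq> E \<and> card I \<le> d}"
      using sub[of I J] by auto
  next
    fix I J assume "I \<in> {I. I \<subseteq> E \<and> card I \<le> d}" "J \<in> {I. I \<subseteq> E \<and> card I \<le> d}"
      "card I < card J"
    then show "\<exists>e\<in>J - I. insert e I \<in> {I. I \<subseteq> E \<and> card I \<le> d}"
      using ex[of I J] by simp
  qed (use assms in auto)
qed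


section \<open>Tutte polynomial and h-vector\<close>

text \<open>The Tutte polynomial evaluated at a point of an arbitrary commutative ring. The polynomial
  \<open>T(x,1)\<close> in one variable is the evaluation at \<open>([:0, 1:], 1)\<close> in the ring \<open>int poly\<close>.\<close>

definition tutte :: "'a matroid \<Rightarrow> 'r::comm_ring_1 \<Rightarrow> 'r \<Rightarrow> 'r" where
  "tutte N x y =
     (\<Sum>A\<in>Pow (ground N). (x - 1) ^ (matroid_rank N - matroid_rk N A) *
                           (y - 1) ^ (card A - matroid_rk N A))"

text \<open>The sequence \<open>h\<^sub>0, \<dots>, h\<^sub>d\<close> is extended by zeros beyond the rank \<open>d\<close>.\<close>

definition h_vec :: "'a matroid \<Rightarrow> nat \<Rightarrow> int" where
  "h_vec N k =
     (if k \<le> matroid_rank N then coeff (tutte N [:0, 1:] 1) (matroid_rank N - k) else 0)"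

lemma tutte_eq_h_vec:
  "tutte N [:0, 1:] 1 = (\<Sum>k\<le>matroid_rank N. smult (h_vec N k) ([:0, 1:] ^ (matroid_rank N - k)))"
proof -
  let ?d = "matroid_rank N"
  let ?T = "tutte N [:0, 1:] 1 :: int poly"
  have "degree ?T \<le> ?d"
  proof (cases "finite (ground N)")
    case True
    have eq: "[:0, 1:] - 1 = [:-1, 1 :: int:]" by (simp only: one_pCons diff_pCons) simp
    have deg: "degree ([:-1, 1 :: int:] ^ j) \<le> j" for j
      using degree_power_le[of "[:-1, 1 :: int:]" j] by simp
    have "degree (([:0, 1:] - 1) ^ (?d - matroid_rk N A) *
             (1 - 1 :: int poly) ^ (card A - matroid_rk N A)) \<le> ?d" for A
      unfolding eq using deg[of "?d - matroid_rk N A"]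
      by (cases "card A - matroid_rk N A") auto
    then show ?thesis
      unfolding tutte_def using True by (intro degree_sum_le) auto
  qed (simp add: tutte_def)
  then have "?T = (\<Sum>j\<le>?d. monom (coeff ?T j) j)"
    by (rule poly_as_sum_of_monoms'[symmetric])
  also have "\<dots> = (\<Sum>k\<le>?d. monom (coeff ?T (?d - k)) (?d - k))"
    by (rule sum.reindex_bij_witness[of _ "\<lambda>k. ?d - k" "\<lambda>k. ?d - k"]) auto
  also have "\<dots> = (\<Sum>k\<le>?d. smult (h_vec N k) ([:0, 1:] ^ (?d - k)))"
    by (intro sum.cong refl) (simp add: h_vec_def monom_altdef[symmetric])
  finally show ?thesis .
qed


section \<open>Multicomplexes\<close>

text \<open>Monomials in the variables \<open>V\<close> are exponent vectors vanishing outside \<open>V\<close>; division of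
  monomials is the pointwise order on functions.\<close>

definition exp_vecs :: "'v set \<Rightarrow> ('v \<Rightarrow> nat) set" where
  "exp_vecs V = {m. \<forall>i. i \<notin> V \<longrightarrow> m i = 0}"

definition mon_degree :: "'v set \<Rightarrow> ('v \<Rightarrow> nat) \<Rightarrow> nat" where
  "mon_degree V m = (\<Sum>i\<in>V. m i)"

definition multicomplex :: "'v set \<Rightarrow> ('v \<Rightarrow> nat) set \<Rightarrow> bool" where
  "multicomplex V S \<longleftrightarrow>
     finite S \<and> S \<subseteq> exp_vecs V \<and> (\<forall>m\<in>S. \<forall>m'\<in>exp_vecs V. m' \<le> m \<longrightarrow> m' \<in> S)"

definition maximal_monomials :: "('v \<Rightarrow> nat) set \<Rightarrow> ('v \<Rightarrow> nat) set" where
  "maximal_monomials S = {m \<in> S. \<forall>m'\<in>S. m \<le> m' \<longrightarrow> m' = m}"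

definition pure_multicomplex :: "'v set \<Rightarrow> ('v \<Rightarrow> nat) set \<Rightarrow> bool" where
  "pure_multicomplex V S \<longleftrightarrow>
     multicomplex V S \<and>
     (\<forall>m\<in>maximal_monomials S. \<forall>m'\<in>maximal_monomials S. mon_degree V m = mon_degree V m')"

definition degree_sequence :: "'v set \<Rightarrow> ('v \<Rightarrow> nat) set \<Rightarrow> nat \<Rightarrow> nat" where
  "degree_sequence V S k = card {m \<in> S. mon_degree V m = k}"

text \<open>Sequences are compared as functions on \<open>nat\<close>, finite ones being extended by zeros; this is
  what ignoring trailing zeros amounts to. Variables indexed by natural numbers suffice, since a
  multicomplex involves finitely many variables.\<close>

definition pure_O_sequence :: "(nat \<Rightarrow> int) \<Rightarrow> bool" where
  "pure_O_sequence h \<longleftrightarrow>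
     (\<exists>(V :: nat set) S. finite V \<and> pure_multicomplex V S \<and>
        (\<forall>k. h k = int (degree_sequence V S k)))"


section \<open>Strata and fibres\<close>

definition fund_circuit :: "'a matroid \<Rightarrow> 'a set \<Rightarrow> 'a \<Rightarrow> 'a set" where
  "fund_circuit M B\<^sub>0 i = (THE C. is_circuit M C \<and> C \<subseteq> insert i B\<^sub>0)"

definition cover_mult :: "'a matroid \<Rightarrow> 'a set \<Rightarrow> 'a set \<Rightarrow> 'a \<Rightarrow> nat" where
  "cover_mult M B\<^sub>0 \<sigma> e = card {i \<in> \<sigma>. e \<in> fund_circuit M B\<^sub>0 i}"

definition U_set :: "'a matroid \<Rightarrow> 'a set \<Rightarrow> 'a set \<Rightarrow> 'a set" where
  "U_set M B\<^sub>0 \<sigma> = {e \<in> ground M. cover_mult M B\<^sub>0 \<sigma> e = 1}"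

definition A_set :: "'a matroid \<Rightarrow> 'a set \<Rightarrow> 'a set \<Rightarrow> 'a set" where
  "A_set M B\<^sub>0 \<sigma> = {e \<in> ground M. cover_mult M B\<^sub>0 \<sigma> e \<ge> 1}"

definition is_stratum :: "'a matroid \<Rightarrow> 'a set \<Rightarrow> 'a set \<Rightarrow> bool" where
  "is_stratum M B\<^sub>0 \<sigma> \<longleftrightarrow> \<sigma> \<noteq> {} \<and> \<sigma> \<subseteq> ground M - B\<^sub>0"

definition is_dead :: "'a matroid \<Rightarrow> 'a set \<Rightarrow> 'a set \<Rightarrow> bool" where
  "is_dead M B\<^sub>0 \<sigma> \<longleftrightarrow> is_stratum M B\<^sub>0 \<sigma> \<and> U_set M B\<^sub>0 \<sigma> \<in> indeps M"

definition baseline :: "'a matroid \<Rightarrow> 'a set \<Rightarrow> 'a set \<Rightarrow> 'a \<Rightarrow> nat" where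
  "baseline M B\<^sub>0 \<sigma> i = (if i \<in> \<sigma> then card (fund_circuit M B\<^sub>0 i \<inter> U_set M B\<^sub>0 \<sigma>) else 0)"

definition can_fire :: "'a matroid \<Rightarrow> 'a set \<Rightarrow> 'a set \<Rightarrow> ('a \<Rightarrow> nat) \<Rightarrow> bool" where
  "can_fire M B\<^sub>0 \<sigma> a \<longleftrightarrow> (\<forall>i\<in>\<sigma>. a i \<ge> baseline M B\<^sub>0 \<sigma> i)"

definition dead_node :: "'a matroid \<Rightarrow> 'a set \<Rightarrow> 'a set \<Rightarrow> 'a matroid" where
  "dead_node M B\<^sub>0 \<sigma> = matroid_contract (matroid_restrict M (A_set M B\<^sub>0 \<sigma>)) (U_set M B\<^sub>0 \<sigma>)"

definition vec_restrict :: "('a \<Rightarrow> nat) \<Rightarrow> 'a set \<Rightarrow> 'a \<Rightarrow> nat" where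
  "vec_restrict a \<tau> i = (if i \<in> \<tau> then a i else 0)"

text \<open>\<open>S\<close> is a fibre at \<open>\<sigma>\<close>, relative to the fibres \<open>F \<tau>\<close> at the dead \<open>\<tau> \<subset> \<sigma>\<close>. The truncated
  subtraction is exact, because \<open>\<tau>\<close> can be fired from the vector concerned. Values of \<open>F\<close> at sets
  that are not dead strata are never used.\<close>

definition is_fibre ::
  "'a matroid \<Rightarrow> 'a set \<Rightarrow> ('a set \<Rightarrow> ('a \<Rightarrow> nat) set) \<Rightarrow> 'a set \<Rightarrow> ('a \<Rightarrow> nat) set \<Rightarrow> bool" where
  "is_fibre M B\<^sub>0 F \<sigma> S \<longleftrightarrow>
     pure_multicomplex \<sigma> S \<and>
     (\<forall>k. int (degree_sequence \<sigma> S k) = h_vec (dead_node M B\<^sub>0 \<sigma>) k) \<and>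
     (\<forall>m\<in>S. \<forall>\<tau>. is_stratum M B\<^sub>0 \<tau> \<and> \<tau> \<subset> \<sigma> \<and>
          can_fire M B\<^sub>0 \<tau> (\<lambda>i. baseline M B\<^sub>0 \<sigma> i + m i) \<longrightarrow>
        is_dead M B\<^sub>0 \<tau> \<and>
        (\<lambda>i. vec_restrict (\<lambda>j. baseline M B\<^sub>0 \<sigma> j + m j) \<tau> i - baseline M B\<^sub>0 \<tau> i) \<in> F \<tau>)"

definition fibre_system ::
  "'a matroid \<Rightarrow> 'a set \<Rightarrow> ('a set \<Rightarrow> ('a \<Rightarrow> nat) set) \<Rightarrow> bool" where
  "fibre_system M B\<^sub>0 F \<longleftrightarrow>
     is_matroid M \<and> is_basis M B\<^sub>0 \<and> (\<forall>\<sigma>. is_dead M B\<^sub>0 \<sigma> \<longrightarrow> is_fibre M B\<^sub>0 F \<sigma> (F \<sigma>))"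

end

theory Submission
  imports Defs
begin

text \<open>
  In \<open>U\<^bsub>d,n\<^esub>\<close> every circuit has exactly \<open>d + 1\<close> elements and \<open>B\<^sub>0\<close> has \<open>d\<close>, so the fundamental
  circuit of \<open>i\<close> fills up \<open>B\<^sub>0 \<union> {i}\<close>. An element of \<open>B\<^sub>0\<close> therefore lies on all circuits \<open>C\<^sub>i\<close> with
  \<open>i \<in> \<sigma>\<close>, and \<open>i \<in> \<sigma>\<close> lies on \<open>C\<^sub>i\<close> only. Hence \<open>U\<^sub>\<sigma>\<close> is a whole circuit, and \<open>\<sigma>\<close> is live, when
  \<open>\<sigma>\<close> is a singleton; as soon as \<open>\<sigma>\<close> has two elements, \<open>U\<^sub>\<sigma> = \<sigma>\<close>, which is independent iff
  \<open>|\<sigma>| \<le> d\<close>. Deleting and contracting elements of a uniform matroid gives uniform matroids, so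
  the dead node at \<open>\<sigma>\<close> is the uniform matroid of rank \<open>d - |\<sigma>|\<close> on the set \<open>B\<^sub>0\<close>.

  The enumerative core is that for \<open>U\<^bsub>r,N\<^esub>\<close> the number \<open>h\<^sub>k\<close> is \<open>(N - r + k - 1) choose k\<close>, which is
  also the number of monomials of degree \<open>k\<close> in \<open>N - r\<close> variables
  (\<open>h_vec_uniform\<close>, \<open>card_monomials_of_degree\<close>). So \<open>h(U\<^bsub>r,N\<^esub>)\<close> is the degree sequence of the
  complex of all monomials of degree at most \<open>r\<close> in \<open>N - r\<close> variables, and this complex is pure.
  For the dead node, \<open>N = d\<close> and \<open>r = d - |\<sigma>|\<close>, so that the \<open>|\<sigma>|\<close> elements of \<open>\<sigma>\<close> serve as the
  variables. The same statement for \<open>N = n\<close>, \<open>r = d\<close> is Stanley's conjecture for \<open>U\<^bsub>d,n\<^esub>\<close>.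

  The firing condition holds for degree reasons. From \<open>b\<^sub>\<sigma> + m\<close>, with \<open>|m| \<le> d - |\<sigma>|\<close>, no singleton
  can be fired, because its baseline is \<open>d + 1\<close> while all entries of \<open>b\<^sub>\<sigma> + m\<close> are at most
  \<open>d - |\<sigma>| + 1\<close>. For a larger \<open>\<tau>\<close> the baseline vector is the restriction of \<open>b\<^sub>\<sigma>\<close>, so what remains
  is \<open>m\<close> restricted to \<open>\<tau>\<close>, of degree at most \<open>d - |\<sigma>| \<le> d - |\<tau>|\<close>.
\<close>

section \<open>Monomials of bounded degree\<close>

text \<open>Listing the exponents along an enumeration of the variables turns monomials into lists of
  naturals with prescribed length and sum.\<close>

lemma card_monomials_of_degree:
  assumes "finite V"
  shows "card {m \<in> exp_vecs V. mon_degree V m = k} = (card V + k - 1) choose k"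
proof -
  obtain xs where xs: "set xs = V" "distinct xs"
    using finite_distinct_list[OF assms] by blast
  have len: "length xs = card V"
    using xs distinct_card by fastforce
  have "bij_betw (\<lambda>m. map m xs) {m \<in> exp_vecs V. mon_degree V m = k}
          {l. length l = card V \<and> sum_list l = k}"
    unfolding bij_betw_def
  proof (intro conjI subset_antisym subsetI)
    show "inj_on (\<lambda>m. map m xs) {m \<in> exp_vecs V. mon_degree V m = k}"
    proof (rule inj_onI)
      fix m m' assume m: "m \<in> {m \<in> exp_vecs V. mon_degree V m = k}"
        "m' \<in> {m \<in> exp_vecs V. mon_degree V m = k}" "map m xs = map m' xs"
      have "m i = m' i" for i
        using m xs(1) by (cases "i \<in> V") (auto simp: exp_vecs_def)
      then show "m = m'" ..
    qed
  next
    fix l assume "l \<in> (\<lambda>m. map m xs) ` {m \<in> exp_vecs V. mon_degree V m = k}"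
    then show "l \<in> {l. length l = card V \<and> sum_list l = k}"
      using xs len by (auto simp: mon_degree_def sum_list_distinct_conv_sum_set)
  next
    fix l assume l: "l \<in> {l. length l = card V \<and> sum_list l = k}"
    define m where "m i = (if i \<in> V then the (map_of (zip xs l) i) else 0)" for i
    have m: "map m xs = l"
    proof (rule nth_equalityI)
      fix j assume "j < length (map m xs)"
      then show "map m xs ! j = l ! j"
        using l len xs map_of_zip_nth[of xs l j] by (auto simp: m_def)
    qed (use l len in simp)
    have "mon_degree V m = sum_list l"
      using xs by (simp add: mon_degree_def sum_list_distinct_conv_sum_set flip: m)
    then have "m \<in> {m \<in> exp_vecs V. mon_degree V m = k}"
      using l by (simp add: exp_vecs_def m_def)
    then show "l \<in> (\<lambda>m. map m xs) ` {m \<in> exp_vecs V. mon_degree V m = k}"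
      using m by blast
  qed
  then show ?thesis
    using card_length_sum_list[of "card V" k] by (simp add: bij_betw_same_card add.commute)
qed

lemma finite_monomials_of_degree_le:
  assumes "finite V"
  shows "finite {m \<in> exp_vecs V. mon_degree V m \<le> D}"
proof (rule finite_subset)
  show "{m \<in> exp_vecs V. mon_degree V m \<le> D} \<subseteq>
      {m. \<forall>i. (i \<in> V \<longrightarrow> m i \<in> {..D}) \<and> (i \<notin> V \<longrightarrow> m i = 0)}"
  proof (intro subsetI CollectI allI conjI impI)
    fix m i assume m: "m \<in> {m \<in> exp_vecs V. mon_degree V m \<le> D}"
    show "m i \<in> {..D}" if "i \<in> V"
      using m member_le_sum[of i V m] that assms by (simp add: mon_degree_def)
    show "m i = 0" if "i \<notin> V"
      using m that by (simp add: exp_vecs_def)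
  qed
qed (use assms in \<open>intro finite_set_of_finite_funs; simp\<close>)

text \<open>A monomial of degree less than \<open>D\<close> can be multiplied by any variable, so the maximal ones
  all have degree \<open>D\<close>, unless there are no variables and \<open>1\<close> is the only monomial.\<close>

lemma pure_multicomplex_degree_le:
  assumes "finite V"
  shows "pure_multicomplex V {m \<in> exp_vecs V. mon_degree V m \<le> D}" (is "pure_multicomplex V ?S")
proof -
  have mono: "mon_degree V m' \<le> mon_degree V m" if "m' \<le> m" for m m' :: "'a \<Rightarrow> nat"
    using that by (auto simp: mon_degree_def le_fun_def intro: sum_mono)
  have mc: "multicomplex V ?S"
    unfolding multicomplex_def
    using finite_monomials_of_degree_le[OF assms] by (auto intro: order_trans[OF mono])
  have top: "mon_degree V m = D" if m: "m \<in> maximal_monomials ?S" and v: "v \<in> V" for m v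
  proof (rule ccontr)
    assume "mon_degree V m \<noteq> D"
    then have lt: "mon_degree V m < D"
      using m by (auto simp: maximal_monomials_def)
    let ?m = "m(v := m v + 1)"
    have "mon_degree V ?m = mon_degree V m + 1"
      using sum.remove[OF assms v, of m] sum.remove[OF assms v, of ?m]
      by (simp add: mon_degree_def)
    then have "?m \<in> ?S"
      using lt m v by (auto simp: maximal_monomials_def exp_vecs_def)
    moreover have "m \<le> ?m"
      by (simp add: le_fun_def)
    ultimately have "?m = m"
      using m unfolding maximal_monomials_def by blast
    then show False
      by (metis fun_upd_same n_not_Suc_n Suc_eq_plus1)
  qed
  show ?thesis
  proof (cases "V = {}")
    case True
    then show ?thesis using mc by (simp add: pure_multicomplex_def mon_degree_def)
  next
    case False
    then show ?thesis using mc top unfolding pure_multicomplex_def by blast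
  qed
qed


section \<open>Uniform matroids\<close>

lemma ground_uniform [simp]: "ground (uniform_matroid d E) = E"
  by (simp add: uniform_matroid_def)

lemma indeps_uniform [simp]: "I \<in> indeps (uniform_matroid d E) \<longleftrightarrow> I \<subseteq> E \<and> card I \<le> d"
  by (simp add: uniform_matroid_def)

lemma rk_uniform:
  assumes "finite E" "A \<subseteq> E"
  shows "matroid_rk (uniform_matroid d E) A = min d (card A)"
proof -
  have finA: "finite A"
    using assms by (rule finite_subset[rotated])
  have "card ` {I \<in> indeps (uniform_matroid d E). I \<subseteq> A} = {..min d (card A)}"
  proof (intro subset_antisym subsetI)
    fix j assume "j \<in> {..min d (card A)}"
    then obtain I where "I \<subseteq> A" "card I = j"
      using obtain_subset_with_card_n[of j A] by auto
    then show "j \<in> card ` {I \<in> indeps (uniform_matroid d E). I \<subseteq> A}"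
      using \<open>j \<in> {..min d (card A)}\<close> assms(2) by (auto intro!: image_eqI[of _ card I])
  qed (use card_mono[OF finA] in auto)
  moreover have "Max {..n} = n" for n :: nat
    by (rule Max_eqI) auto
  ultimately show ?thesis
    by (simp add: matroid_rk_def)
qed

lemma restrict_uniform: "matroid_restrict (uniform_matroid d E) A = uniform_matroid d (E \<inter> A)"
  by (auto simp: matroid_restrict_def uniform_matroid_def)

lemma contract_uniform:
  assumes "finite E" "X \<subseteq> E" "card X \<le> d"
  shows "matroid_contract (uniform_matroid d E) X = uniform_matroid (d - card X) (E - X)"
proof -
  have "matroid_rk (uniform_matroid d E) (I \<union> X) = card I + matroid_rk (uniform_matroid d E) X
      \<longleftrightarrow> card I \<le> d - card X" if I: "I \<subseteq> E - X" for I
  proof -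
    have "card (I \<union> X) = card I + card X"
      using I assms by (intro card_Un_disjoint) (auto intro: finite_subset)
    moreover have "I \<union> X \<subseteq> E"
      using I assms by auto
    ultimately show ?thesis
      using rk_uniform[OF assms(1)] assms by (simp add: min_def) linarith
  qed
  then show ?thesis
    by (auto simp: matroid_contract_def uniform_matroid_def)
qed

lemma iso_uniform:
  assumes "finite E" "finite E'" "card E = card E'"
  shows "matroid_iso (uniform_matroid d E) (uniform_matroid d E')"
proof -
  obtain f where f: "bij_betw f E E'"
    using finite_same_card_bij[OF assms] by blast
  have "card (f ` I) = card I \<and> f ` I \<subseteq> E'" if "I \<subseteq> E" for I
    using that f by (auto simp: bij_betw_def intro: card_image inj_on_subset)
  then show ?thesis
    unfolding matroid_iso_def using f by (intro exI[of _ f]) simp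
qed

lemma circuit_uniform:
  assumes "finite E"
  shows "is_circuit (uniform_matroid d E) C \<longleftrightarrow> C \<subseteq> E \<and> card C = d + 1"
proof
  assume C: "is_circuit (uniform_matroid d E) C"
  then have sub: "C \<subseteq> E" and big: "d < card C"
    by (auto simp: is_circuit_def)
  then obtain e where e: "e \<in> C" by fastforce
  have "C - {e} \<in> indeps (uniform_matroid d E)"
    using C e unfolding is_circuit_def by blast
  then show "C \<subseteq> E \<and> card C = d + 1"
    using sub big e by auto
next
  assume C: "C \<subseteq> E \<and> card C = d + 1"
  have "D \<in> indeps (uniform_matroid d E)" if "D \<subset> C" for D
  proof -
    have "card D < card C"
      using that C assms by (meson finite_subset psubset_card_mono)
    then show ?thesis
      using that C by auto
  qed
  then show "is_circuit (uniform_matroid d E) C"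
    using C unfolding is_circuit_def by simp
qed

lemma card_basis_uniform:
  assumes "finite E" "d \<le> card E" "is_basis (uniform_matroid d E) B"
  shows "card B = d"
proof (rule ccontr)
  assume "card B \<noteq> d"
  then have B: "B \<subseteq> E" "card B < d"
    using assms(3) by (auto simp: is_basis_def)
  then have "B \<noteq> E"
    using assms(2) by auto
  then obtain e where e: "e \<in> E" "e \<notin> B"
    using B by blast
  have "insert e B \<in> indeps (uniform_matroid d E)"
    using B e assms(1) by (simp add: card_insert_if finite_subset)
  then have "insert e B = B"
    using assms(3) unfolding is_basis_def by blast
  then show False
    using e by blast
qed


section \<open>The h-vector of a uniform matroid\<close>

text \<open>At \<open>y = 1\<close> the summand of \<open>A\<close> contains a power of \<open>0\<close> whose exponent is the nullity of \<open>A\<close>, so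
  only independent sets contribute, and these are counted by size.\<close>

lemma tutte_uniform:
  fixes x :: "'r :: comm_ring_1"
  assumes "finite E" "d \<le> card E"
  shows "tutte (uniform_matroid d E) x 1 = (\<Sum>j\<le>d. of_nat (card E choose j) * (x - 1) ^ (d - j))"
proof -
  let ?N = "uniform_matroid d E"
  let ?t = "\<lambda>A. (x - 1) ^ (matroid_rank ?N - matroid_rk ?N A) * (1 - 1) ^ (card A - matroid_rk ?N A)"
  let ?P = "\<lambda>j. {A. A \<subseteq> E \<and> card A = j}"
  have rk: "matroid_rk ?N A = min d (card A)" if "A \<subseteq> E" for A
    using rk_uniform[OF assms(1) that] .
  have small: "?t A = (x - 1) ^ (d - card A)" if "A \<subseteq> E" "card A \<le> d" for A
    using that rk[of A] rk[of E] assms(2) by simp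
  have large: "?t A = 0" if "A \<subseteq> E" "d < card A" for A
    using that rk[of A] by (simp add: power_0_left)
  have "tutte ?N x 1 = (\<Sum>A\<in>Pow E. ?t A)"
    by (simp only: tutte_def ground_uniform)
  also have "\<dots> = (\<Sum>A | A \<subseteq> E \<and> card A \<le> d. ?t A)"
    using assms(1) large by (intro sum.mono_neutral_right) (auto simp: not_le)
  also have "\<dots> = (\<Sum>A | A \<subseteq> E \<and> card A \<le> d. (x - 1) ^ (d - card A))"
    using small by (intro sum.cong) auto
  also have "\<dots> = (\<Sum>j\<le>d. \<Sum>A | A \<in> {A. A \<subseteq> E \<and> card A \<le> d} \<and> card A = j. (x - 1) ^ (d - card A))"
    using assms(1) by (intro sum.group[symmetric]) auto
  also have "\<dots> = (\<Sum>j\<le>d. \<Sum>A\<in>?P j. (x - 1) ^ (d - j))"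
    by (intro sum.cong) auto
  finally show ?thesis
    using n_subsets[OF assms(1)] by simp
qed

text \<open>Write \<open>P(N,r)\<close> for the left-hand side below with \<open>N = s + r\<close>. Pascal's rule gives
  \<open>P(N + 1, r + 1) = P(N, r + 1) + P(N, r)\<close>, and splitting off the last summand gives
  \<open>P(N, r + 1) = (x - 1) P(N, r) + (N choose (r + 1))\<close>. Together,
  \<open>P(N + 1, r + 1) = x P(N, r) + (N choose (r + 1))\<close>: with \<open>s\<close> fixed, raising \<open>r\<close> by one shifts
  the coefficients in powers of \<open>x\<close> and appends one new constant term.\<close>

lemma sum_choose_shift:
  fixes x :: "'r :: comm_ring_1"
  shows "(\<Sum>j\<le>r. of_nat ((s + r) choose j) * (x - 1) ^ (r - j)) =
         (\<Sum>k\<le>r. of_nat ((s + k - 1) choose k) * x ^ (r - k))"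
proof (induction r)
  case 0
  then show ?case by simp
next
  case (Suc r)
  define N where "N = s + r"
  define P where "P M r = (\<Sum>j\<le>r. of_nat (M choose j) * (x - 1) ^ (r - j))" for M r
  have step: "P N (Suc r) = (x - 1) * P N r + of_nat (N choose Suc r)"
    unfolding P_def by (simp add: sum_distrib_left Suc_diff_le mult_ac)
  have "P (Suc N) (Suc r) = (x - 1) ^ Suc r +
      (\<Sum>j\<le>r. of_nat (Suc N choose Suc j) * (x - 1) ^ (r - j))"
    unfolding P_def by (subst sum.atMost_Suc_shift) simp
  also have "\<dots> = (x - 1) ^ Suc r + (\<Sum>j\<le>r. of_nat (N choose Suc j) * (x - 1) ^ (r - j)) + P N r"
    by (simp add: P_def algebra_simps sum.distrib)
  also have "\<dots> = P N (Suc r) + P N r"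
    by (simp add: P_def sum.atMost_Suc_shift del: sum.atMost_Suc)
  finally have "P (Suc N) (Suc r) = x * P N r + of_nat (N choose Suc r)"
    using step by (simp add: algebra_simps)
  moreover have "P N r = (\<Sum>k\<le>r. of_nat ((s + k - 1) choose k) * x ^ (r - k))"
    using Suc by (simp add: P_def N_def)
  ultimately have "P (Suc N) (Suc r) =
      x * (\<Sum>k\<le>r. of_nat ((s + k - 1) choose k) * x ^ (r - k)) + of_nat (N choose Suc r)"
    by simp
  then show ?case
    unfolding P_def N_def by (simp add: sum_distrib_left Suc_diff_le mult_ac del: sum.atMost_Suc)
       (simp add: mult_ac Suc_diff_le)
qed

lemma h_vec_uniform:
  assumes "finite E" "d \<le> card E"
  shows "h_vec (uniform_matroid d E) k =
    (if k \<le> d then int ((card E - d + k - 1) choose k) else 0)"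
proof -
  let ?c = "\<lambda>j. (card E - d + j - 1) choose j"
  have rank: "matroid_rank (uniform_matroid d E) = d"
    using rk_uniform[OF assms(1), of E d] assms(2) by simp
  have "tutte (uniform_matroid d E) [:0, 1 :: int:] 1 = (\<Sum>j\<le>d. of_nat (?c j) * [:0, 1:] ^ (d - j))"
    using sum_choose_shift[of "card E - d" d] assms by (simp add: tutte_uniform)
  also have "\<dots> = (\<Sum>j\<le>d. monom (int (?c j)) (d - j))"
    by (simp add: monom_altdef of_nat_poly)
  finally have T: "tutte (uniform_matroid d E) [:0, 1 :: int:] 1 =
    (\<Sum>j\<le>d. monom (int (?c j)) (d - j))" .
  have "coeff (tutte (uniform_matroid d E) [:0, 1 :: int:] 1) (d - k) = int (?c k)" if "k \<le> d"
  proof -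
    have "coeff (tutte (uniform_matroid d E) [:0, 1 :: int:] 1) (d - k) =
        (\<Sum>j\<le>d. if j = k then int (?c j) else 0)"
      unfolding T coeff_sum using that by (intro sum.cong) (auto simp: coeff_monom)
    also have "\<dots> = int (?c k)"
      using that by simp
    finally show ?thesis .
  qed
  then show ?thesis
    unfolding h_vec_def rank by (cases "k \<le> d") simp_all
qed

text \<open>The two binomial formulas agree in every degree up to \<open>d\<close>, and bounding the degree of the
  monomials by \<open>d\<close> cuts the sequence off where the h-vector ends.\<close>

lemma degree_sequence_eq_h_vec_uniform:
  assumes "finite E" "d \<le> card E" "finite V" "card V = card E - d"
  shows "int (degree_sequence V {m \<in> exp_vecs V. mon_degree V m \<le> d} k) =
    h_vec (uniform_matroid d E) k"
proof -
  have "{m \<in> {m \<in> exp_vecs V. mon_degree V m \<le> d}. mon_degree V m = k} =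
      (if k \<le> d then {m \<in> exp_vecs V. mon_degree V m = k} else {})"
    by auto
  then show ?thesis
    using card_monomials_of_degree[OF assms(3), of k] assms
    by (simp add: degree_sequence_def h_vec_uniform)
qed

lemma pure_O_sequence_uniform:
  assumes "finite E" "d \<le> card E"
  shows "pure_O_sequence (h_vec (uniform_matroid d E))"
proof -
  let ?V = "{..<card E - d}"
  have "pure_multicomplex ?V {m \<in> exp_vecs ?V. mon_degree ?V m \<le> d}"
    by (intro pure_multicomplex_degree_le) simp
  moreover have "\<forall>k. h_vec (uniform_matroid d E) k =
      int (degree_sequence ?V {m \<in> exp_vecs ?V. mon_degree ?V m \<le> d} k)"
    using degree_sequence_eq_h_vec_uniform[OF assms, of ?V] by simp
  ultimately show ?thesis
    unfolding pure_O_sequence_def by blast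
qed


section \<open>Strata of a uniform matroid\<close>

locale uniform_with_basis =
  fixes E B :: "'a set" and d :: nat
  assumes finite_E: "finite E"
    and rank_le: "d \<le> card E"
    and basis: "is_basis (uniform_matroid d E) B"
begin

abbreviation M :: "'a matroid" where "M \<equiv> uniform_matroid d E"

lemma B_sub: "B \<subseteq> E"
  using basis unfolding is_basis_def indeps_uniform by (elim conjE)

lemma card_B: "card B = d"
  using card_basis_uniform[OF finite_E rank_le basis] .

lemma finite_B: "finite B"
  using B_sub finite_E by (rule finite_subset)

lemma fund_circuit_eq:
  assumes "i \<in> E - B"
  shows "fund_circuit M B i = insert i B"
  unfolding fund_circuit_def
proof (rule the_equality)
  have card: "card (insert i B) = d + 1"
    using assms card_B finite_B by simp
  then show "is_circuit M (insert i B) \<and> insert i B \<subseteq> insert i B"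
    using assms B_sub circuit_uniform[OF finite_E] by simp
  show "C = insert i B" if "is_circuit M C \<and> C \<subseteq> insert i B" for C
    using that card circuit_uniform[OF finite_E, of d C] finite_B by (intro card_subset_eq) auto
qed

lemma stratum_finite: "is_stratum M B \<sigma> \<Longrightarrow> finite \<sigma>"
  using finite_E by (auto simp: is_stratum_def intro: finite_subset)

lemma cover_mult_eq:
  assumes "is_stratum M B \<sigma>" "e \<in> E"
  shows "cover_mult M B \<sigma> e = (if e \<in> B then card \<sigma> else if e \<in> \<sigma> then 1 else 0)"
proof -
  have "{i \<in> \<sigma>. e \<in> fund_circuit M B i} = (if e \<in> B then \<sigma> else \<sigma> \<inter> {e})"
    using assms fund_circuit_eq by (auto simp: is_stratum_def)
  then show ?thesis
    by (auto simp: cover_mult_def)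
qed

lemma A_set_eq:
  assumes "is_stratum M B \<sigma>"
  shows "A_set M B \<sigma> = B \<union> \<sigma>"
proof -
  have "card \<sigma> \<ge> 1"
    using assms stratum_finite[OF assms] by (simp add: is_stratum_def Suc_le_eq card_gt_0_iff)
  moreover have "\<sigma> \<subseteq> E - B"
    using assms by (simp add: is_stratum_def)
  ultimately show ?thesis
    using B_sub by (auto simp: A_set_def cover_mult_eq[OF assms] split: if_splits)
qed

lemma U_set_eq:
  assumes "is_stratum M B \<sigma>" "card \<sigma> \<noteq> 1"
  shows "U_set M B \<sigma> = \<sigma>"
proof -
  have sub: "\<sigma> \<subseteq> E - B"
    using assms(1) by (simp add: is_stratum_def)
  have "cover_mult M B \<sigma> e = 1 \<longleftrightarrow> e \<in> \<sigma>" if "e \<in> E" for e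
    unfolding cover_mult_eq[OF assms(1) that] using assms(2) sub by (cases "e \<in> B") auto
  then show ?thesis
    using sub by (auto simp: U_set_def)
qed

lemma U_set_singleton:
  assumes "is_stratum M B {i}"
  shows "U_set M B {i} = insert i B"
proof -
  have i: "i \<in> E - B"
    using assms by (simp add: is_stratum_def)
  have "cover_mult M B {i} e = 1 \<longleftrightarrow> e \<in> insert i B" if "e \<in> E" for e
    unfolding cover_mult_eq[OF assms that] by simp
  then show ?thesis
    using i B_sub by (auto simp: U_set_def)
qed

lemma dead_iff: "is_dead M B \<sigma> \<longleftrightarrow> \<sigma> \<subseteq> E - B \<and> 2 \<le> card \<sigma> \<and> card \<sigma> \<le> d"
proof (cases "is_stratum M B \<sigma>")
  case True
  then have sub: "\<sigma> \<subseteq> E - B" and pos: "card \<sigma> \<noteq> 0"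
    using stratum_finite[OF True] by (auto simp: is_stratum_def)
  show ?thesis
  proof (cases "card \<sigma> = 1")
    case card1: True
    then obtain i where i: "\<sigma> = {i}"
      by (rule card_1_singletonE)
    have "card (U_set M B \<sigma>) = d + 1"
      using U_set_singleton[of i] True sub i card_B finite_B by simp
    then show ?thesis
      using card1 by (simp add: is_dead_def)
  next
    case False
    then have "2 \<le> card \<sigma>"
      using pos by linarith
    then show ?thesis
      using U_set_eq[OF True False] True sub by (auto simp: is_dead_def)
  qed
next
  case False
  then show ?thesis
    by (auto simp: is_dead_def is_stratum_def)
qed

lemma dead_stratum: "is_dead M B \<sigma> \<Longrightarrow> is_stratum M B \<sigma>"
  by (simp add: is_dead_def)

lemma dead_U_set:
  assumes "is_dead M B \<sigma>"
  shows "U_set M B \<sigma> = \<sigma>"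
  using assms dead_iff[of \<sigma>] by (intro U_set_eq[OF dead_stratum]) auto

lemma stratum_baseline:
  assumes "is_stratum M B \<sigma>" "card \<sigma> \<noteq> 1" "i \<in> \<sigma>"
  shows "baseline M B \<sigma> i = 1"
proof -
  have "fund_circuit M B i \<inter> \<sigma> = {i}"
    using assms fund_circuit_eq[of i] by (auto simp: is_stratum_def)
  then show ?thesis
    using assms U_set_eq by (simp add: baseline_def)
qed

lemma dead_baseline:
  assumes "is_dead M B \<sigma>" "i \<in> \<sigma>"
  shows "baseline M B \<sigma> i = 1"
  using assms dead_iff[of \<sigma>] by (intro stratum_baseline[OF dead_stratum]) auto

lemma baseline_singleton:
  assumes "is_stratum M B {i}"
  shows "baseline M B {i} i = d + 1"
proof -
  have i: "i \<in> E - B"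
    using assms by (simp add: is_stratum_def)
  then show ?thesis
    using U_set_singleton[OF assms] fund_circuit_eq[OF i] card_B finite_B
    by (simp add: baseline_def)
qed

lemma dead_node_eq:
  assumes "is_dead M B \<sigma>"
  shows "dead_node M B \<sigma> = uniform_matroid (d - card \<sigma>) B"
proof -
  have \<sigma>: "\<sigma> \<subseteq> E - B" "card \<sigma> \<le> d"
    using assms dead_iff by auto
  then have sets: "E \<inter> (B \<union> \<sigma>) = B \<union> \<sigma>" "B \<union> \<sigma> - \<sigma> = B"
    using B_sub by auto
  have "finite (B \<union> \<sigma>)"
    using finite_B stratum_finite[OF dead_stratum[OF assms]] by simp
  then show ?thesis
    using \<sigma> sets contract_uniform[of "B \<union> \<sigma>" \<sigma> d] dead_U_set[OF assms]
      A_set_eq[OF dead_stratum[OF assms]]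
    by (simp add: dead_node_def restrict_uniform)
qed

text \<open>A subset of \<open>\<sigma>\<close> is not too large to be dead, so only singletons need excluding. Firing one
  requires an entry \<open>d + 1\<close>, whereas all entries of \<open>b\<^sub>\<sigma> + m\<close> together add up to at most \<open>d\<close>.\<close>

lemma dead_fired_substratum:
  assumes \<sigma>: "is_dead M B \<sigma>" and m: "mon_degree \<sigma> m \<le> d - card \<sigma>"
    and \<tau>: "is_stratum M B \<tau>" "\<tau> \<subseteq> \<sigma>"
    and fire: "can_fire M B \<tau> (\<lambda>i. baseline M B \<sigma> i + m i)"
  shows "is_dead M B \<tau>"
proof -
  have fin: "finite \<sigma>"
    using stratum_finite[OF dead_stratum[OF \<sigma>]] .
  have card: "2 \<le> card \<sigma>" "card \<sigma> \<le> d"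
    using \<sigma> dead_iff by auto
  have "card \<tau> \<noteq> 1"
  proof
    assume "card \<tau> = 1"
    then obtain i where i: "\<tau> = {i}"
      by (rule card_1_singletonE)
    then have "i \<in> \<sigma>"
      using \<tau> by simp
    then have "m i \<le> mon_degree \<sigma> m"
      using fin by (simp add: mon_degree_def member_le_sum)
    moreover have "d + 1 \<le> 1 + m i"
      using fire baseline_singleton \<tau>(1) dead_baseline[OF \<sigma> \<open>i \<in> \<sigma>\<close>] by (simp add: i can_fire_def)
    ultimately show False
      using m card by linarith
  qed
  moreover have "card \<tau> \<noteq> 0"
    using \<tau>(1) stratum_finite[OF \<tau>(1)] by (auto simp: is_stratum_def)
  ultimately have "2 \<le> card \<tau>"
    by linarith
  then show ?thesis
    using \<tau> card card_mono[OF fin \<tau>(2)] by (auto simp: dead_iff is_stratum_def)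
qed

lemma remainder_in_fibre:
  assumes \<sigma>: "is_dead M B \<sigma>" and m: "mon_degree \<sigma> m \<le> d - card \<sigma>"
    and \<tau>: "is_dead M B \<tau>" "\<tau> \<subseteq> \<sigma>"
  shows "(\<lambda>i. vec_restrict (\<lambda>j. baseline M B \<sigma> j + m j) \<tau> i - baseline M B \<tau> i)
    \<in> {m \<in> exp_vecs \<tau>. mon_degree \<tau> m \<le> d - card \<tau>}"
proof -
  have fin: "finite \<sigma>"
    using stratum_finite[OF dead_stratum[OF \<sigma>]] .
  have eq: "(\<lambda>i. vec_restrict (\<lambda>j. baseline M B \<sigma> j + m j) \<tau> i - baseline M B \<tau> i) =
      vec_restrict m \<tau>"
    using \<tau>(2) dead_baseline[OF \<sigma>] dead_baseline[OF \<tau>(1)] by (fastforce simp: vec_restrict_def)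
  have "mon_degree \<tau> (vec_restrict m \<tau>) \<le> mon_degree \<sigma> m"
    using sum_mono2[OF fin \<tau>(2), of m] by (simp add: mon_degree_def vec_restrict_def)
  also have "\<dots> \<le> d - card \<tau>"
    using m card_mono[OF fin \<tau>(2)] by linarith
  finally show ?thesis
    unfolding eq by (simp add: exp_vecs_def vec_restrict_def)
qed

lemma fibre_system_uniform:
  "fibre_system M B (\<lambda>\<sigma>. {m \<in> exp_vecs \<sigma>. mon_degree \<sigma> m \<le> d - card \<sigma>})"
proof -
  have "is_fibre M B (\<lambda>\<sigma>. {m \<in> exp_vecs \<sigma>. mon_degree \<sigma> m \<le> d - card \<sigma>}) \<sigma>
      {m \<in> exp_vecs \<sigma>. mon_degree \<sigma> m \<le> d - card \<sigma>}" if \<sigma>: "is_dead M B \<sigma>" for \<sigma>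
  proof -
    have fin: "finite \<sigma>"
      using stratum_finite[OF dead_stratum[OF \<sigma>]] .
    have "card \<sigma> = card B - (d - card \<sigma>)"
      using \<sigma> card_B by (simp add: dead_iff)
    then have "int (degree_sequence \<sigma> {m \<in> exp_vecs \<sigma>. mon_degree \<sigma> m \<le> d - card \<sigma>} k) =
        h_vec (dead_node M B \<sigma>) k" for k
      using degree_sequence_eq_h_vec_uniform[OF finite_B, of "d - card \<sigma>" \<sigma>] fin card_B
      by (simp add: dead_node_eq[OF \<sigma>])
    moreover have "is_dead M B \<tau> \<and>
        (\<lambda>i. vec_restrict (\<lambda>j. baseline M B \<sigma> j + m j) \<tau> i - baseline M B \<tau> i)
          \<in> {m \<in> exp_vecs \<tau>. mon_degree \<tau> m \<le> d - card \<tau>}"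
      if "m \<in> {m \<in> exp_vecs \<sigma>. mon_degree \<sigma> m \<le> d - card \<sigma>}"
        and "is_stratum M B \<tau> \<and> \<tau> \<subset> \<sigma> \<and> can_fire M B \<tau> (\<lambda>i. baseline M B \<sigma> i + m i)" for m \<tau>
    proof -
      have m: "mon_degree \<sigma> m \<le> d - card \<sigma>" and sub: "\<tau> \<subseteq> \<sigma>"
        using that by auto
      then have "is_dead M B \<tau>"
        using that(2) by (intro dead_fired_substratum[OF \<sigma> m]) auto
      then show ?thesis
        using remainder_in_fibre[OF \<sigma> m _ sub] by blast
    qed
    ultimately show ?thesis
      unfolding is_fibre_def using pure_multicomplex_degree_le[OF fin] by blast
  qed
  then show ?thesis
    using is_matroid_uniform[OF finite_E] basis by (simp add: fibre_system_def)
qed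

end


section \<open>The fibre system and Stanley's conjecture for uniform matroids\<close>

theorem theorem6p9:
  fixes E B\<^sub>0 R :: "'a set" and M :: "'a matroid" and d n :: nat
  assumes "finite E" and "card E = n" and "2 \<le> d" and "d \<le> n"
    and "M = uniform_matroid d E"
    and "is_basis M B\<^sub>0"
    and "R = E - B\<^sub>0"
  shows "(\<forall>i\<in>R. fund_circuit M B\<^sub>0 i = B\<^sub>0 \<union> {i}) \<and>
    (\<forall>\<sigma>. is_dead M B\<^sub>0 \<sigma> \<longleftrightarrow> \<sigma> \<subseteq> R \<and> 2 \<le> card \<sigma> \<and> card \<sigma> \<le> d) \<and>
    (\<forall>\<sigma>. is_dead M B\<^sub>0 \<sigma> \<longrightarrow>
       U_set M B\<^sub>0 \<sigma> = \<sigma> \<and>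
       (\<forall>i\<in>\<sigma>. baseline M B\<^sub>0 \<sigma> i = 1) \<and>
       matroid_iso (dead_node M B\<^sub>0 \<sigma>) (uniform_matroid (d - card \<sigma>) {..<d})) \<and>
    fibre_system M B\<^sub>0 (\<lambda>\<sigma>. {m \<in> exp_vecs \<sigma>. mon_degree \<sigma> m \<le> d - card \<sigma>}) \<and>
    pure_O_sequence (h_vec M)"
proof -
  interpret uniform_with_basis E B\<^sub>0 d
    using assms by unfold_locales auto
  have "matroid_iso (dead_node (uniform_matroid d E) B\<^sub>0 \<sigma>) (uniform_matroid (d - card \<sigma>) {..<d})"
    if "is_dead (uniform_matroid d E) B\<^sub>0 \<sigma>" for \<sigma>
    using iso_uniform[OF finite_B, of "{..<d}"] card_B by (simp add: dead_node_eq[OF that])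
  then show ?thesis
    unfolding \<open>M = uniform_matroid d E\<close> \<open>R = E - B\<^sub>0\<close>
    using fund_circuit_eq dead_iff dead_U_set dead_baseline fibre_system_uniform
      pure_O_sequence_uniform[OF finite_E rank_le]
    by simp
qed

end
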